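(* Let $n\ge2$, $N\ge3$ and $\nu\in SYD(N,n)$. The map $$\bar{\mathcal J}_\nu:SSSYT(\nu)\to\mathfrak{GTP}(\nu),\qquad(\nu^{(1)},\dots,\nu^{(N)})\mapsto(\beta^{(N)},\beta^{(N-1)},\dots,\beta^{(3)},z),$$ defined, for $3\le k\le N$, by $$\beta^{(k)}=\begin{cases}s(\nu^{(k)}),&\nu^{(k)}\ne\nu^{(k)\dagger},\\ \nu^{(k)},&\nu^{(k)}=\nu^{(k)\dagger}\text{ and }(-1)^{|\nu^{(k-1)}|}=1,\\ (\nu^{(k)})^\sigma,&\nu^{(k)}=\nu^{(k)\dagger}\text{ and }(-1)^{|\nu^{(k-1)}|}=-1,\end{cases}$$ and by $z=|s(\nu^{(2)})|$ if $\nu^{(1)}=\emptyset$, $z=-|s(\nu^{(2)})|$ if $\nu^{(1)}\ne\emptyset$, is a bijection.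
   Context: $SYD(N,n)$ is the set of Young diagrams with at most $n$ columns whose first two columns have total length at most $N$ (short Young diagrams of height $N$). For $\nu\in SYD(k,n)$, regarded as a short Young diagram of height $k$, $\nu^\dagger$ is obtained from $\nu$ by replacing the length $\nu_1^t$ of the first column by $k-\nu_1^t$; $s(\nu)=\nu$ if $\nu_1^t\le k/2$ and $s(\nu)=\nu^\dagger$ otherwise; $|\nu|$ is the number of boxes. A diagram with at most $\lfloor k/2\rfloor$ rows is regarded as a weight of $\mathfrak o_k(\mathbb C)$, i.e. a tuple of $\lfloor k/2\rfloor$ integers padded with zeros. For $k=2m$ and $\beta=(\beta_1,\dots,\beta_m)$, $\beta^\sigma=(\beta_1,\dots,\beta_{m-1},-\beta_m)$. $SSSYT(\nu)$, $\nu\in SYD(N,n)$, is the set of semi-standard short Young tables of shape $\nu$: sequences $(\nu^{(1)},\dots,\nu^{(N)})$ with $\nu^{(i)}\in SYD(i,n)$ (regarded as of height $i$), $\nu^{(N)}=\nu$, $\nu^{(i)}\subset\nu^{(i+1)}$, and $\nu^{(i+1)}-\nu^{(i)}$ a horizontal strip (at most one box per column), $1\le i<N$. $\mathfrak{GTP}(\nu)$ is the set of Gelfand–Tsetlin patterns: sequences $(\beta^{(N)},\dots,\beta^{(3)},z)$ where $\beta^{(k)}$ is a dominant weight of $\mathfrak o_k(\mathbb C)$ with integer coordinates ($\beta_1\ge\dots\ge\beta_m\ge0$ if $k=2m+1$; $\beta_1\ge\dots\ge\beta_{m-1}\ge|\beta_m|$ if $k=2m$), $z\in\mathbb Z$,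 $\beta^{(N)}=s(\nu)$ if $\nu\neq\nu^\dagger$ and $\beta^{(N)}\in\{\nu,\nu^\sigma\}$ if $\nu=\nu^\dagger$, $\beta^{(k)}\succcurlyeq\beta^{(k-1)}$ for $4\le k\le N$, and $\beta^{(3)}\ge|z|$. Here, for $\beta$ a weight of $\mathfrak o_k$ and $\mu$ of $\mathfrak o_{k-1}$, $\beta\succcurlyeq\mu$ means $\beta_1\ge\mu_1\ge\beta_2\ge\mu_2\ge\dots\ge\mu_{d-1}\ge\beta_d\ge|\mu_d|$ if $k=2d+1$, and $\beta_1\ge\mu_1\ge\beta_2\ge\dots\ge\mu_{d-1}\ge|\beta_d|$ if $k=2d$. *)

theory Defs
  imports Main "HOL-Library.FuncSet"
begin

text \<open>
  A Young diagram is its set of boxes: \<open>(i, j)\<close> is the box in row \<open>i\<close> and column \<open>j\<close>,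
  both counted from 0, so that \<open>col_len \<nu> 0\<close> is the length of the first column.
\<close>

type_synonym diagram = "(nat \<times> nat) set"

definition young_diagram :: "diagram \<Rightarrow> bool" where
  "young_diagram \<nu> \<longleftrightarrow>
     finite \<nu> \<and> (\<forall>i j i' j'. (i, j) \<in> \<nu> \<and> i' \<le> i \<and> j' \<le> j \<longrightarrow> (i', j') \<in> \<nu>)"

definition row_len :: "diagram \<Rightarrow> nat \<Rightarrow> nat" where
  "row_len \<nu> i = card {j. (i, j) \<in> \<nu>}"

definition col_len :: "diagram \<Rightarrow> nat \<Rightarrow> nat" where
  "col_len \<nu> j = card {i. (i, j) \<in> \<nu>}"

text \<open>The number of columns of a Young diagram is the length of its first row.\<close>

definition SYD :: "nat \<Rightarrow> nat \<Rightarrow> diagram set" where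
  "SYD N n = {\<nu>. young_diagram \<nu> \<and> row_len \<nu> 0 \<le> n \<and> col_len \<nu> 0 + col_len \<nu> 1 \<le> N}"

text \<open>
  The operations \<open>\<nu>\<^sup>\<dagger>\<close> and \<open>s(\<nu>)\<close> depend on the height \<open>k\<close> that is attached to the diagram.
  The subtraction does not truncate when \<open>\<nu> \<in> SYD k n\<close>.
\<close>

definition dagger :: "nat \<Rightarrow> diagram \<Rightarrow> diagram" where
  "dagger k \<nu> = {(i, j). if j = 0 then i < k - col_len \<nu> 0 else (i, j) \<in> \<nu>}"

definition short_rep :: "nat \<Rightarrow> diagram \<Rightarrow> diagram" where
  "short_rep k \<nu> = (if 2 * col_len \<nu> 0 \<le> k then \<nu> else dagger k \<nu>)"

definition horizontal_strip :: "(nat \<times> nat) set \<Rightarrow> bool" where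
  "horizontal_strip S \<longleftrightarrow> (\<forall>j. card {i. (i, j) \<in> S} \<le> 1)"

text \<open>
  Sequences \<open>(\<nu>\<^sup>(\<^sup>1\<^sup>), \<dots>, \<nu>\<^sup>(\<^sup>N\<^sup>))\<close> are functions on the index set \<open>{1..N}\<close>, made unique by being
  \<open>undefined\<close> outside of it.
\<close>

definition SSSYT :: "nat \<Rightarrow> nat \<Rightarrow> diagram \<Rightarrow> (nat \<Rightarrow> diagram) set" where
  "SSSYT N n \<nu> =
     {T \<in> (\<Pi>\<^sub>E i\<in>{1..N}. SYD i n).
        T N = \<nu> \<and>
        (\<forall>i. 1 \<le> i \<and> i < N \<longrightarrow> T i \<subseteq> T (i + 1) \<and> horizontal_strip (T (i + 1) - T i))}"

text \<open>
  A weight of \<open>\<oo>\<^sub>k\<close> is an integer list of length \<open>k div 2\<close>; the coordinate \<open>\<beta>\<^sub>i\<close> is \<open>\<beta> ! (i - 1)\<close>.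
\<close>

definition weight_of :: "nat \<Rightarrow> diagram \<Rightarrow> int list" where
  "weight_of k \<nu> = map (\<lambda>i. int (row_len \<nu> i)) [0..<k div 2]"

definition sigma :: "int list \<Rightarrow> int list" where
  "sigma \<beta> = butlast \<beta> @ [- last \<beta>]"

definition dominant_weights :: "nat \<Rightarrow> int list set" where
  "dominant_weights k =
     {\<beta>. length \<beta> = k div 2 \<and>
         (if odd k
          then sorted_wrt (\<ge>) \<beta> \<and> (\<forall>x\<in>set \<beta>. 0 \<le> x)
          else sorted_wrt (\<ge>) (butlast \<beta>) \<and> (\<forall>x\<in>set (butlast \<beta>). \<bar>last \<beta>\<bar> \<le> x))}"

text \<open>
  \<open>branches k \<beta> \<mu>\<close> is the relation \<open>\<beta> \<succcurlyeq> \<mu>\<close> for a weight \<open>\<beta>\<close> of \<open>\<oo>\<^sub>k\<close> and a weight \<open>\<mu>\<close> of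
  \<open>\<oo>\<^sub>k\<^sub>-\<^sub>1\<close>, used for \<open>k \<ge> 4\<close>.  For \<open>k = 2 * d\<close> the last entry of \<open>\<mu>\<close> is \<open>\<mu> ! (d - 2)\<close>.
\<close>

definition branches :: "nat \<Rightarrow> int list \<Rightarrow> int list \<Rightarrow> bool" where
  "branches k \<beta> \<mu> \<longleftrightarrow>
     (let d = k div 2 in
      if odd k
      then (\<forall>i. i + 1 < d \<longrightarrow> \<beta> ! i \<ge> \<mu> ! i \<and> \<mu> ! i \<ge> \<beta> ! (i + 1)) \<and>
           \<beta> ! (d - 1) \<ge> \<bar>\<mu> ! (d - 1)\<bar>
      else (\<forall>i. i + 1 < d \<longrightarrow> \<beta> ! i \<ge> \<mu> ! i) \<and>
           (\<forall>i. i + 2 < d \<longrightarrow> \<mu> ! i \<ge> \<beta> ! (i + 1)) \<and>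
           \<mu> ! (d - 2) \<ge> \<bar>\<beta> ! (d - 1)\<bar>)"

definition GTP :: "nat \<Rightarrow> diagram \<Rightarrow> ((nat \<Rightarrow> int list) \<times> int) set" where
  "GTP N \<nu> =
     {(\<beta>, z). \<beta> \<in> (\<Pi>\<^sub>E k\<in>{3..N}. dominant_weights k) \<and>
        (if \<nu> \<noteq> dagger N \<nu>
         then \<beta> N = weight_of N (short_rep N \<nu>)
         else \<beta> N \<in> {weight_of N \<nu>, sigma (weight_of N \<nu>)}) \<and>
        (\<forall>k. 4 \<le> k \<and> k \<le> N \<longrightarrow> branches k (\<beta> k) (\<beta> (k - 1))) \<and>
        \<beta> 3 ! 0 \<ge> \<bar>z\<bar>}"

definition J_map :: "nat \<Rightarrow> (nat \<Rightarrow> diagram) \<Rightarrow> (nat \<Rightarrow> int list) \<times> int" where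
  "J_map N T =
     (\<lambda>k\<in>{3..N}.
        if T k \<noteq> dagger k (T k) then weight_of k (short_rep k (T k))
        else if (-1 :: int) ^ card (T (k - 1)) = 1 then weight_of k (T k)
        else sigma (weight_of k (T k)),
      if T 1 = {} then int (card (short_rep 2 (T 2))) else - int (card (short_rep 2 (T 2))))"

end

theory Submission imports Defs begin

text \<open>A horizontal strip means that all column lengths grow by 0 or 1, a condition that is preserved
  when \<open>\<dagger>\<close> is applied at heights \<open>k\<close> and \<open>k - 1\<close> simultaneously. Hence every step of a tableau gives
  a step between the short representatives, and for these a step is the interlacing of row
  lengths, that is \<open>\<succcurlyeq>\<close> for the absolute values of the weights.

  Conversely, reading a pattern from the top, \<open>\<nu>\<^sup>(\<^sup>k\<^sup>)\<close> and \<open>s(\<nu>\<^sup>(\<^sup>k\<^sup>-\<^sup>1\<^sup>))\<close> leave only the choice between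
  \<open>s(\<nu>\<^sup>(\<^sup>k\<^sup>-\<^sup>1\<^sup>))\<close> and its dagger. If \<open>\<nu>\<^sup>(\<^sup>k\<^sup>)\<close> is not self-dual, the length of its first column decides.
  If it is, then \<open>k - 1\<close> is odd, both choices are admissible, and their sizes have different
  parities, so the sign of the last coordinate of \<open>\<beta>\<^sup>(\<^sup>k\<^sup>)\<close> decides. The bottom fits the same scheme
  when \<open>z\<close> is read as the weight \<open>[z]\<close> of height 2, above the empty weight of height 1.\<close>

section \<open>Young diagrams described by row and column lengths\<close>

lemma young_diagramD:
  assumes "young_diagram \<nu>" "(i, j) \<in> \<nu>" "i' \<le> i" "j' \<le> j"
  shows "(i', j') \<in> \<nu>"
  using assms unfolding young_diagram_def by blast

lemma down_closed_eq_lessThan_card: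
  fixes A :: "nat set"
  assumes "finite A" "\<And>x y. x \<in> A \<Longrightarrow> y \<le> x \<Longrightarrow> y \<in> A"
  shows "A = {..<card A}"
proof (cases "A = {}")
  case False
  have "A = {..Max A}"
    using assms False by (auto intro: Max_ge Max_in)
  then have "A = {..<Suc (Max A)}"
    by (simp add: lessThan_Suc_atMost)
  then show ?thesis
    by (metis card_lessThan)
qed simp

lemma mem_iff_col_len:
  assumes "young_diagram \<nu>"
  shows "(i, j) \<in> \<nu> \<longleftrightarrow> i < col_len \<nu> j"
proof -
  have "{i. (i, j) \<in> \<nu>} \<subseteq> fst ` \<nu>"
    by force
  then have "finite {i. (i, j) \<in> \<nu>}"
    using assms finite_subset unfolding young_diagram_def by blast
  then have "{i. (i, j) \<in> \<nu>} = {..<col_len \<nu> j}"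
    unfolding col_len_def using young_diagramD[OF assms]
    by (intro down_closed_eq_lessThan_card) auto
  then show ?thesis
    by blast
qed

lemma mem_iff_row_len:
  assumes "young_diagram \<nu>"
  shows "(i, j) \<in> \<nu> \<longleftrightarrow> j < row_len \<nu> i"
proof -
  have "{j. (i, j) \<in> \<nu>} \<subseteq> snd ` \<nu>"
    by force
  then have "finite {j. (i, j) \<in> \<nu>}"
    using assms finite_subset unfolding young_diagram_def by blast
  then have "{j. (i, j) \<in> \<nu>} = {..<row_len \<nu> i}"
    unfolding row_len_def using young_diagramD[OF assms]
    by (intro down_closed_eq_lessThan_card) auto
  then show ?thesis
    by blast
qed

lemma col_len_antimono:
  assumes "young_diagram \<nu>" "j \<le> j'"
  shows "col_len \<nu> j' \<le> col_len \<nu> j"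
proof (rule ccontr)
  assume "\<not> col_len \<nu> j' \<le> col_len \<nu> j"
  then have "(col_len \<nu> j, j') \<in> \<nu>"
    using mem_iff_col_len[OF assms(1)] by simp
  then have "(col_len \<nu> j, j) \<in> \<nu>"
    using young_diagramD assms by blast
  then show False
    using mem_iff_col_len[OF assms(1)] by simp
qed

lemma diagram_eqI:
  assumes "young_diagram \<nu>" "young_diagram \<mu>" "\<And>i. row_len \<nu> i = row_len \<mu> i"
  shows "\<nu> = \<mu>"
  using assms by (auto simp: mem_iff_row_len)

lemma row_len_mono:
  assumes "young_diagram \<nu>" "young_diagram \<mu>" "\<nu> \<subseteq> \<mu>"
  shows "row_len \<nu> i \<le> row_len \<mu> i"
  using assms mem_iff_row_len by (metis linorder_not_less subsetD order_less_irrefl)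

lemma col_len_0_le_iff:
  assumes "young_diagram \<nu>"
  shows "col_len \<nu> 0 \<le> i \<longleftrightarrow> row_len \<nu> i = 0"
  using mem_iff_col_len[OF assms, of i 0] mem_iff_row_len[OF assms, of i 0] by auto

section \<open>Horizontal strips as interlacing of lengths\<close>

definition strip_step :: "diagram \<Rightarrow> diagram \<Rightarrow> bool" where
  "strip_step \<kappa> \<mu> \<longleftrightarrow> \<mu> \<subseteq> \<kappa> \<and> horizontal_strip (\<kappa> - \<mu>)"

text \<open>Column \<open>j\<close> of \<open>\<kappa> - \<mu>\<close> is the interval between the
  two column lengths, so the strip condition bounds their difference by one, while the inclusion
  compares them from the other side.\<close>

lemma strip_step_iff_col_len:
  assumes "young_diagram \<kappa>" "young_diagram \<mu>"
  shows "strip_step \<kappa> \<mu> \<longleftrightarrow> (\<forall>j. col_len \<mu> j \<le> col_len \<kappa> j \<and> col_len \<kappa> j \<le> Suc (col_len \<mu> j))"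
proof -
  have "{i. (i, j) \<in> \<kappa> - \<mu>} = {col_len \<mu> j..<col_len \<kappa> j}" for j
    using assms by (auto simp: mem_iff_col_len)
  then have "horizontal_strip (\<kappa> - \<mu>) \<longleftrightarrow> (\<forall>j. col_len \<kappa> j \<le> Suc (col_len \<mu> j))"
    unfolding horizontal_strip_def by (simp add: le_diff_conv)
  moreover have "\<mu> \<subseteq> \<kappa> \<longleftrightarrow> (\<forall>j. col_len \<mu> j \<le> col_len \<kappa> j)"
    using mem_iff_col_len[OF assms(1)] mem_iff_col_len[OF assms(2)]
    by (auto simp: subset_iff) (meson linorder_not_less order_less_irrefl, meson order_less_le_trans)
  ultimately show ?thesis
    unfolding strip_step_def by blast
qed

text \<open>Transposing the column criterion: an excess of at most one box in every column means
  that each box of \<open>\<kappa>\<close> below the first row has a box of \<open>\<mu>\<close>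
  directly above its place, which is the interlacing of consecutive rows.\<close>

lemma strip_step_iff_row_len:
  assumes "young_diagram \<kappa>" "young_diagram \<mu>"
  shows "strip_step \<kappa> \<mu> \<longleftrightarrow> (\<forall>i. row_len \<mu> i \<le> row_len \<kappa> i \<and> row_len \<kappa> (Suc i) \<le> row_len \<mu> i)"
proof -
  have mem: "i < col_len \<kappa> j \<longleftrightarrow> j < row_len \<kappa> i" "i < col_len \<mu> j \<longleftrightarrow> j < row_len \<mu> i" for i j
    using assms mem_iff_col_len mem_iff_row_len by blast+
  \<comment> \<open>Inequalities between lengths become inclusions of initial segments, so that
    \<open>mem\<close> can exchange rows and columns.\<close>
  have le_iff: "m \<le> m' \<longleftrightarrow> (\<forall>x < m. x < m')" for m m' :: nat
    by (meson linorder_not_less order_less_irrefl order_less_le_trans)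
  have "(\<forall>j. col_len \<mu> j \<le> col_len \<kappa> j) \<longleftrightarrow> (\<forall>i. row_len \<mu> i \<le> row_len \<kappa> i)"
    unfolding le_iff mem by blast
  moreover have "col_len \<kappa> j \<le> Suc (col_len \<mu> j) \<longleftrightarrow> (\<forall>i. Suc i < col_len \<kappa> j \<longrightarrow> i < col_len \<mu> j)" for j
    by (cases "col_len \<kappa> j") (auto simp: le_iff[of _ "col_len \<mu> j"])
  then have "(\<forall>j. col_len \<kappa> j \<le> Suc (col_len \<mu> j)) \<longleftrightarrow> (\<forall>i. row_len \<kappa> (Suc i) \<le> row_len \<mu> i)"
    unfolding mem le_iff by blast
  ultimately show ?thesis
    unfolding strip_step_iff_col_len[OF assms] by blast
qed

section \<open>The dagger and the short representative\<close>

text \<open>Only the height enters the dagger; the bound \<open>n\<close> on the width is inherited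
  by subdiagrams and is restored in \<open>ex1_pattern_step\<close>.\<close>

definition short_diagram :: "nat \<Rightarrow> diagram \<Rightarrow> bool" where
  "short_diagram k \<nu> \<longleftrightarrow> young_diagram \<nu> \<and> col_len \<nu> 0 + col_len \<nu> 1 \<le> k"

lemma SYD_iff: "\<nu> \<in> SYD k n \<longleftrightarrow> short_diagram k \<nu> \<and> row_len \<nu> 0 \<le> n"
  unfolding SYD_def short_diagram_def by auto

lemma short_diagramI:
  assumes "young_diagram \<nu>" "2 * col_len \<nu> 0 \<le> k"
  shows "short_diagram k \<nu>"
  using assms col_len_antimono[OF assms(1), of 0 1] unfolding short_diagram_def by simp

context
  fixes k :: nat and \<nu> :: diagram
  assumes short: "short_diagram k \<nu>"
begin

lemma col_len_dagger: "col_len (dagger k \<nu>) j = (if j = 0 then k - col_len \<nu> 0 else col_len \<nu> j)"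
  unfolding col_len_def dagger_def by auto

text \<open>Changing the first column can only break closure to the left. A box in a later column
  has row index less than \<open>col_len \<nu> 1\<close>, and shortness bounds this by the new first
  column length.\<close>

lemma young_dagger: "young_diagram (dagger k \<nu>)"
  unfolding young_diagram_def
proof (intro conjI allI impI)
  have y: "young_diagram \<nu>" and le: "col_len \<nu> 0 + col_len \<nu> 1 \<le> k"
    using short unfolding short_diagram_def by auto
  have "dagger k \<nu> \<subseteq> {..<k} \<times> {0} \<union> \<nu>"
    unfolding dagger_def by (auto split: if_splits)
  then show "finite (dagger k \<nu>)"
    using y finite_subset unfolding young_diagram_def by blast
  fix i j i' j' :: nat
  assume *: "(i, j) \<in> dagger k \<nu> \<and> i' \<le> i \<and> j' \<le> j"
  show "(i', j') \<in> dagger k \<nu>"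
  proof (cases "j = 0 \<or> j' > 0")
    case True
    then show ?thesis
      using * young_diagramD[OF y] unfolding dagger_def by auto
  next
    case False
    then have "(i, j) \<in> \<nu>" "1 \<le> j"
      using * unfolding dagger_def by auto
    then have "i < col_len \<nu> 1"
      using y col_len_antimono[OF y, of 1 j] by (simp add: mem_iff_col_len)
    then show ?thesis
      using * False le unfolding dagger_def by auto
  qed
qed

lemma short_dagger: "short_diagram k (dagger k \<nu>)"
proof -
  have "col_len \<nu> 1 \<le> col_len \<nu> 0" "col_len \<nu> 0 + col_len \<nu> 1 \<le> k"
    using short col_len_antimono[of \<nu> 0 1] unfolding short_diagram_def by auto
  then show ?thesis
    unfolding short_diagram_def using young_dagger by (simp add: col_len_dagger)
qed

lemma dagger_dagger: "dagger k (dagger k \<nu>) = \<nu>"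
proof -
  have y: "young_diagram \<nu>" and le: "col_len \<nu> 0 \<le> k"
    using short unfolding short_diagram_def by auto
  have "(i, j) \<in> dagger k (dagger k \<nu>) \<longleftrightarrow> (i, j) \<in> \<nu>" for i j
  proof (cases "j = 0")
    case True
    then have "(i, j) \<in> dagger k (dagger k \<nu>) \<longleftrightarrow> i < k - col_len (dagger k \<nu>) 0"
      by (simp add: dagger_def[of k "dagger k \<nu>"])
    then show ?thesis
      using True le by (simp add: col_len_dagger mem_iff_col_len[OF y])
  qed (simp add: dagger_def)
  then show ?thesis
    by auto
qed

lemma dagger_eq_iff: "\<nu> = dagger k \<nu> \<longleftrightarrow> 2 * col_len \<nu> 0 = k"
proof
  assume "\<nu> = dagger k \<nu>"
  then have "col_len \<nu> 0 = k - col_len \<nu> 0"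
    using col_len_dagger[of 0] by simp
  moreover have "col_len \<nu> 0 \<le> k"
    using short unfolding short_diagram_def by auto
  ultimately show "2 * col_len \<nu> 0 = k"
    by linarith
next
  assume "2 * col_len \<nu> 0 = k"
  then have "k - col_len \<nu> 0 = col_len \<nu> 0"
    by linarith
  moreover have "young_diagram \<nu>"
    using short unfolding short_diagram_def by auto
  ultimately show "\<nu> = dagger k \<nu>"
    unfolding dagger_def by (auto simp: mem_iff_col_len)
qed

text \<open>Only the first column changes; \<open>R\<close> is the common rest. The old length is
  added on the left to avoid a further subtraction of natural numbers.\<close>

lemma card_dagger: "card (dagger k \<nu>) + col_len \<nu> 0 = card \<nu> + (k - col_len \<nu> 0)"
proof -
  define R where "R = {(i, j) \<in> \<nu>. j \<noteq> 0}"
  have y: "young_diagram \<nu>"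
    using short unfolding short_diagram_def by auto
  have fin: "finite R"
    unfolding R_def using y by (auto simp: young_diagram_def intro: finite_subset)
  have *: "card ({..<c} \<times> {0} \<union> R) = c + card R" for c :: nat
    using fin by (subst card_Un_disjoint) (auto simp: R_def card_cartesian_product)
  have "\<nu> = {..<col_len \<nu> 0} \<times> {0} \<union> R"
    unfolding R_def using y by (auto simp: mem_iff_col_len) (metis gr0I)
  moreover have "dagger k \<nu> = {..<k - col_len \<nu> 0} \<times> {0} \<union> R"
    unfolding R_def dagger_def by (auto split: if_splits)
  ultimately show ?thesis
    using * by (metis add.commute add.left_commute)
qed

text \<open>The first column passes from \<open>c\<close> to \<open>k - c\<close> boxes, numbers of
  opposite parity for odd \<open>k\<close>. This is what lets a sign choose between a diagram and
  its dagger.\<close>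

lemma even_card_dagger_iff: "odd k \<Longrightarrow> even (card (dagger k \<nu>)) \<longleftrightarrow> odd (card \<nu>)"
proof -
  assume "odd k"
  moreover have "col_len \<nu> 0 \<le> k"
    using short unfolding short_diagram_def by auto
  ultimately have "even (k - col_len \<nu> 0) \<longleftrightarrow> odd (col_len \<nu> 0)"
    by simp
  then show ?thesis
    using card_dagger by (metis even_add)
qed

lemma short_short_rep: "short_diagram k (short_rep k \<nu>)"
  using short short_dagger by (simp add: short_rep_def)

lemma col_len_short_rep: "2 * col_len (short_rep k \<nu>) 0 \<le> k"
  by (auto simp: short_rep_def col_len_dagger)

lemma eq_short_rep_or_dagger: "\<nu> = short_rep k \<nu> \<or> \<nu> = dagger k (short_rep k \<nu>)"
  using dagger_dagger by (simp add: short_rep_def)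

lemma self_dual_short_rep_iff: "2 * col_len (short_rep k \<nu>) 0 = k \<longleftrightarrow> 2 * col_len \<nu> 0 = k"
  using short by (auto simp: short_rep_def col_len_dagger short_diagram_def)

end

lemma short_rep_dagger:
  assumes "short_diagram k \<nu>"
  shows "short_rep k (dagger k \<nu>) = short_rep k \<nu>"
proof (cases "2 * col_len \<nu> 0 = k")
  case True
  then show ?thesis
    using dagger_eq_iff[OF assms] by simp
next
  case False
  then show ?thesis
    using assms by (auto simp: short_rep_def col_len_dagger dagger_dagger short_diagram_def)
qed

text \<open>In terms of columns a strip step says that the lengths differ by at most one, and the first
  column lengths \<open>k - c\<close> and \<open>k - 1 - c'\<close> do so exactly when \<open>c\<close> and \<open>c'\<close> do.\<close>

lemma strip_step_dagger:
  assumes "short_diagram (Suc h) \<kappa>" "short_diagram h \<mu>" "strip_step \<kappa> \<mu>"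
  shows "strip_step (dagger (Suc h) \<kappa>) (dagger h \<mu>)"
proof -
  have "young_diagram \<kappa>" "young_diagram \<mu>" "col_len \<kappa> 0 \<le> Suc h" "col_len \<mu> 0 \<le> h"
    using assms(1,2) unfolding short_diagram_def by auto
  then have *: "\<forall>j. col_len \<mu> j \<le> col_len \<kappa> j \<and> col_len \<kappa> j \<le> Suc (col_len \<mu> j)"
    using assms(3) strip_step_iff_col_len by blast
  moreover have "h - col_len \<mu> 0 \<le> Suc h - col_len \<kappa> 0"
    using *[rule_format, of 0] by linarith
  moreover have "Suc h - col_len \<kappa> 0 \<le> Suc (h - col_len \<mu> 0)"
    using *[rule_format, of 0] by linarith
  ultimately show ?thesis
    using assms(1,2) by (simp add: strip_step_iff_col_len young_dagger col_len_dagger)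
qed

text \<open>If the first column of \<open>\<kappa>\<close> lies strictly on one side of half its
  height, that of \<open>\<mu>\<close> lies on the same side or exactly at its own half, so both
  diagrams are kept or both are replaced by their daggers. If \<open>\<kappa>\<close> is self-dual,
  either choice for \<open>\<mu>\<close> gives a step.\<close>

lemma strip_step_short_rep:
  assumes "short_diagram (Suc h) \<kappa>" "short_diagram h \<mu>" "strip_step \<kappa> \<mu>"
  shows "strip_step (short_rep (Suc h) \<kappa>) (short_rep h \<mu>)"
proof -
  have "young_diagram \<kappa>" "young_diagram \<mu>"
    using assms(1,2) unfolding short_diagram_def by auto
  then have c: "col_len \<mu> 0 \<le> col_len \<kappa> 0" "col_len \<kappa> 0 \<le> Suc (col_len \<mu> 0)"
    using assms(3) strip_step_iff_col_len by blast+
  have d: "strip_step (dagger (Suc h) \<kappa>) (dagger h \<mu>)"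
    by (rule strip_step_dagger[OF assms])
  consider "2 * col_len \<kappa> 0 < Suc h" | "2 * col_len \<kappa> 0 > Suc h" | "2 * col_len \<kappa> 0 = Suc h"
    by linarith
  then show ?thesis
  proof cases
    case 1
    then show ?thesis
      using c assms(3) by (simp add: short_rep_def)
  next
    case 2
    \<comment> \<open>When \<open>2 * col_len \<mu> 0 = h\<close> the definition keeps
      \<open>\<mu>\<close>, but then \<open>\<mu>\<close> is its own dagger.\<close>
    then have "short_rep (Suc h) \<kappa> = dagger (Suc h) \<kappa>" "short_rep h \<mu> = dagger h \<mu>"
      using c dagger_eq_iff[OF assms(2)] by (auto simp: short_rep_def)
    then show ?thesis
      using d by simp
  next
    case 3
    then have "dagger (Suc h) \<kappa> = \<kappa>" "short_rep (Suc h) \<kappa> = \<kappa>"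
      using dagger_eq_iff[OF assms(1)] by (auto simp: short_rep_def)
    then show ?thesis
      using d assms(3) by (auto simp: short_rep_def)
  qed
qed

section \<open>Lifting a step from the short representatives\<close>

text \<open>The flag \<open>e\<close> stands for the sign that is later read off the weight. By
  \<open>two\<close> there are at most two candidates; \<open>c\<close> decides between them unless
  \<open>\<kappa>\<close> is self-dual, and then \<open>e\<close> does.\<close>

lemma ex1_strip_step:
  assumes \<kappa>: "short_diagram (Suc h) \<kappa>"
    and \<mu>0: "young_diagram \<mu>\<^sub>0" "2 * col_len \<mu>\<^sub>0 0 \<le> h"
    and step: "strip_step (short_rep (Suc h) \<kappa>) \<mu>\<^sub>0"
  shows "\<exists>!\<mu>. short_diagram h \<mu> \<and> strip_step \<kappa> \<mu> \<and> short_rep h \<mu> = \<mu>\<^sub>0 \<and>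
    (2 * col_len \<kappa> 0 = Suc h \<longrightarrow> (even (card \<mu>) \<longleftrightarrow> e))" (is "\<exists>!\<mu>. ?P \<mu>")
proof -
  have s0: "short_diagram h \<mu>\<^sub>0" and r0: "short_rep h \<mu>\<^sub>0 = \<mu>\<^sub>0"
    using \<mu>0 short_diagramI by (auto simp: short_rep_def)
  have yk: "young_diagram \<kappa>"
    using \<kappa> unfolding short_diagram_def by auto
  have sd: "short_diagram h (dagger h \<mu>\<^sub>0)" and rd: "short_rep h (dagger h \<mu>\<^sub>0) = \<mu>\<^sub>0"
    using s0 r0 short_dagger short_rep_dagger by auto
  have two: "\<mu> = \<mu>\<^sub>0 \<or> \<mu> = dagger h \<mu>\<^sub>0" if "?P \<mu>" for \<mu>
    using that eq_short_rep_or_dagger by blast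
  have c: "col_len \<mu> 0 \<le> col_len \<kappa> 0" "col_len \<kappa> 0 \<le> Suc (col_len \<mu> 0)" if "?P \<mu>" for \<mu>
    using that strip_step_iff_col_len[OF yk] unfolding short_diagram_def by blast+
  consider "2 * col_len \<kappa> 0 < Suc h" | "2 * col_len \<kappa> 0 > Suc h" | "2 * col_len \<kappa> 0 = Suc h"
    by linarith
  then show ?thesis
  proof cases
    case 1
    show ?thesis
    proof (rule ex1I)
      show "?P \<mu>\<^sub>0"
        using 1 s0 r0 step by (auto simp: short_rep_def)
      fix \<mu> assume P: "?P \<mu>"
      then have "2 * col_len \<mu> 0 \<le> h"
        using 1 c by fastforce
      then show "\<mu> = \<mu>\<^sub>0"
        using P by (auto simp: short_rep_def)
    qed
  next
    case 2
    then have *: "short_rep (Suc h) \<kappa> = dagger (Suc h) \<kappa>"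
      by (simp add: short_rep_def)
    \<comment> \<open>The short representative is the dagger of \<open>\<kappa>\<close> here; its
      step to \<open>\<mu>\<^sub>0\<close> is carried back by applying the dagger once more.\<close>
    have "strip_step \<kappa> (dagger h \<mu>\<^sub>0)"
      using strip_step_dagger[OF short_dagger[OF \<kappa>] s0] step dagger_dagger[OF \<kappa>] * by simp
    then have P: "?P (dagger h \<mu>\<^sub>0)"
      using 2 sd rd by auto
    show ?thesis
    proof (rule ex1I, rule P)
      fix \<mu> assume P': "?P \<mu>"
      then have "2 * col_len \<mu> 0 \<ge> h"
        using 2 c by fastforce
      \<comment> \<open>The candidate \<open>\<mu>\<^sub>0\<close> survives only if
        \<open>2 * col_len \<mu>\<^sub>0 0 = h\<close>, and then it equals its dagger.\<close>
      then show "\<mu> = dagger h \<mu>\<^sub>0"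
        using two[OF P'] \<mu>0(2) dagger_eq_iff[OF s0] by auto
    qed
  next
    case 3
    then have *: "short_rep (Suc h) \<kappa> = \<kappa>" "dagger (Suc h) \<kappa> = \<kappa>"
      using dagger_eq_iff[OF \<kappa>] by (auto simp: short_rep_def)
    \<comment> \<open>Self-duality makes \<open>Suc h\<close> even, so \<open>parity\<close>
      applies: the two candidates have sizes of opposite parity, and exactly one agrees with
      \<open>e\<close>.\<close>
    have odd: "odd h"
      using 3 by presburger
    have st: "strip_step \<kappa> \<mu>\<^sub>0" "strip_step \<kappa> (dagger h \<mu>\<^sub>0)"
      using strip_step_dagger[OF \<kappa> s0] step * by simp_all
    note parity = even_card_dagger_iff[OF s0 odd]
    show ?thesis
    proof (cases "even (card \<mu>\<^sub>0) \<longleftrightarrow> e")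
      case True
      show ?thesis
      proof (rule ex1I)
        show "?P \<mu>\<^sub>0"
          using True st s0 r0 by blast
        fix \<mu> assume P: "?P \<mu>"
        then have "even (card \<mu>) \<longleftrightarrow> e"
          using 3 by blast
        then show "\<mu> = \<mu>\<^sub>0"
          using two[OF P] True parity by auto
      qed
    next
      case False
      show ?thesis
      proof (rule ex1I)
        show "?P (dagger h \<mu>\<^sub>0)"
          using False st sd rd parity by blast
        fix \<mu> assume P: "?P \<mu>"
        then have "even (card \<mu>) \<longleftrightarrow> e"
          using 3 by blast
        then show "\<mu> = dagger h \<mu>\<^sub>0"
          using two[OF P] False by auto
      qed
    qed
  qed
qed

section \<open>Weights as diagrams with a sign\<close>

text \<open>Absolute values forget the sign of the last coordinate, so a non-empty weight and its
  image under \<open>sigma\<close> have the same diagram.\<close>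

definition diagram_of :: "int list \<Rightarrow> diagram" where
  "diagram_of \<beta> = {(i, j). i < length \<beta> \<and> int j < \<bar>\<beta> ! i\<bar>}"

lemma row_len_diagram_of: "row_len (diagram_of \<beta>) i = (if i < length \<beta> then nat \<bar>\<beta> ! i\<bar> else 0)"
proof -
  have "{j. int j < \<bar>x\<bar>} = {..<nat \<bar>x\<bar>}" for x
    by auto
  then show ?thesis
    unfolding row_len_def diagram_of_def by simp
qed

text \<open>Only the last coordinate at even height can be negative, and dominance bounds its
  absolute value by all the others. This makes \<open>diagram_of\<close> produce Young
  diagrams.\<close>

lemma dominant_weights_nth_abs_antimono:
  assumes "\<beta> \<in> dominant_weights k" "i \<le> j" "j < length \<beta>"
  shows "\<bar>\<beta> ! j\<bar> \<le> \<bar>\<beta> ! i\<bar>"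
proof (cases "odd k")
  case True
  then have "sorted_wrt (\<ge>) \<beta>" "\<forall>x\<in>set \<beta>. 0 \<le> x"
    using assms(1) unfolding dominant_weights_def by auto
  then show ?thesis
    using assms(2,3) by (cases "i = j") (auto simp: sorted_wrt_iff_nth_less)
next
  case False
  then have s: "sorted_wrt (\<ge>) (butlast \<beta>)" and l: "\<forall>x\<in>set (butlast \<beta>). \<bar>last \<beta>\<bar> \<le> x"
    using assms(1) unfolding dominant_weights_def by auto
  have b: "\<bar>last \<beta>\<bar> \<le> \<beta> ! i'" if "i' < length \<beta> - 1" for i'
    using l that nth_butlast by (metis length_butlast nth_mem)
  have [simp]: "\<beta> \<noteq> []"
    using assms(3) by auto
  consider "i = j" | "i < j" "j = length \<beta> - 1" | "i < j" "j < length \<beta> - 1"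
    using assms by linarith
  then show ?thesis
  proof cases
    case 2
    then show ?thesis
      using b[of i] by (simp add: last_conv_nth)
  next
    case 3
    then have "\<beta> ! j \<le> \<beta> ! i"
      using s by (auto simp: sorted_wrt_iff_nth_less nth_butlast)
    then show ?thesis
      using b[OF 3(2)] by linarith
  qed simp
qed

lemma young_diagram_of:
  assumes "\<beta> \<in> dominant_weights k"
  shows "young_diagram (diagram_of \<beta>)"
  unfolding young_diagram_def
proof (intro conjI allI impI)
  have "diagram_of \<beta> \<subseteq> (\<Union>i<length \<beta>. {i} \<times> {..<nat \<bar>\<beta> ! i\<bar>})"
    unfolding diagram_of_def by auto
  then show "finite (diagram_of \<beta>)"
    by (rule finite_subset) auto
  fix i j i' j' :: nat
  assume "(i, j) \<in> diagram_of \<beta> \<and> i' \<le> i \<and> j' \<le> j"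
  then show "(i', j') \<in> diagram_of \<beta>"
    using dominant_weights_nth_abs_antimono[OF assms, of i' i] unfolding diagram_of_def by auto
qed

lemma col_len_diagram_of:
  assumes "\<beta> \<in> dominant_weights k"
  shows "2 * col_len (diagram_of \<beta>) 0 \<le> k"
proof -
  have "col_len (diagram_of \<beta>) 0 \<le> length \<beta>"
    by (simp add: col_len_0_le_iff young_diagram_of[OF assms] row_len_diagram_of)
  moreover have "length \<beta> = k div 2"
    using assms unfolding dominant_weights_def by auto
  ultimately show ?thesis
    by linarith
qed

text \<open>The bound \<open>(k - 1) div 2\<close> admits all coordinates for odd \<open>k\<close>
  and all but the last for even \<open>k\<close>.\<close>

lemma dominant_weights_nonneg:
  assumes "\<beta> \<in> dominant_weights k" "i < (k - 1) div 2"
  shows "0 \<le> \<beta> ! i"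
proof (cases "odd k")
  case True
  then show ?thesis
    using assms unfolding dominant_weights_def by auto
next
  case False
  have "length \<beta> = k div 2"
    using assms unfolding dominant_weights_def by auto
  then have "i < length (butlast \<beta>)"
    using assms(2) False by auto
  then have "butlast \<beta> ! i \<in> set (butlast \<beta>)" "butlast \<beta> ! i = \<beta> ! i"
    using nth_mem nth_butlast by blast+
  then have "\<bar>last \<beta>\<bar> \<le> \<beta> ! i"
    using assms(1) False unfolding dominant_weights_def by fastforce
  then show ?thesis
    by linarith
qed

text \<open>Up to absolute values the branching inequalities are the interlacing of rows. The one
  coordinate that may be negative is the last one at the even height of the two, and
  \<open>branches\<close> has its absolute value exactly there.\<close>

lemma branches_iff_strip_step:
  assumes "h \<ge> 2" "\<beta> \<in> dominant_weights (Suc h)" "b \<in> dominant_weights h"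
  shows "branches (Suc h) \<beta> b \<longleftrightarrow> strip_step (diagram_of \<beta>) (diagram_of b)"
proof -
  have len: "length \<beta> = Suc h div 2" "length b = h div 2"
    using assms unfolding dominant_weights_def by auto
  have "row_len (diagram_of b) i \<le> row_len (diagram_of \<beta>) i \<longleftrightarrow>
      (i < h div 2 \<longrightarrow> \<bar>b ! i\<bar> \<le> \<bar>\<beta> ! i\<bar>)" for i
    by (auto simp: row_len_diagram_of len nat_le_eq_zle)
  moreover have "row_len (diagram_of \<beta>) (Suc i) \<le> row_len (diagram_of b) i \<longleftrightarrow>
      (Suc i < Suc h div 2 \<longrightarrow> \<bar>\<beta> ! Suc i\<bar> \<le> \<bar>b ! i\<bar>)" for i
    by (auto simp: row_len_diagram_of len nat_le_eq_zle)
  ultimately have strip: "strip_step (diagram_of \<beta>) (diagram_of b) \<longleftrightarrow>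
     (\<forall>i < h div 2. \<bar>b ! i\<bar> \<le> \<bar>\<beta> ! i\<bar>) \<and> (\<forall>i. Suc i < Suc h div 2 \<longrightarrow> \<bar>\<beta> ! Suc i\<bar> \<le> \<bar>b ! i\<bar>)"
    using strip_step_iff_row_len[OF young_diagram_of[OF assms(2)] young_diagram_of[OF assms(3)]]
    by blast
  have pos: "0 \<le> \<beta> ! i" if "i < h div 2" for i
    using dominant_weights_nonneg[OF assms(2)] that by simp
  have pos': "0 \<le> b ! i" if "Suc i < Suc h div 2" for i
    using dominant_weights_nonneg[OF assms(3), of i] that by simp
  show ?thesis
  proof (cases "odd (Suc h)")
    case True
    \<comment> \<open>Here \<open>d\<close> is the last index of both weights, and
      \<open>b ! d\<close> may be negative.\<close>
    define d where "d = h div 2 - 1"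
    have d: "h = 2 * Suc d"
      using True assms(1) unfolding d_def by (auto elim!: evenE)
    have "\<bar>b ! i\<bar> = b ! i" "\<bar>\<beta> ! i\<bar> = \<beta> ! i" "\<bar>\<beta> ! Suc i\<bar> = \<beta> ! Suc i" if "i < d" for i
      using pos[of i] pos[of "Suc i"] pos'[of i] that by (auto simp: d)
    moreover have "\<bar>\<beta> ! d\<bar> = \<beta> ! d"
      using pos[of d] by (simp add: d)
    ultimately show ?thesis
      unfolding strip branches_def Let_def d by (auto simp: All_less_Suc)
  next
    case False
    \<comment> \<open>Here \<open>d\<close> is the last index of \<open>b\<close> and
      \<open>Suc d\<close> that of \<open>\<beta>\<close>; now \<open>\<beta> ! Suc d\<close> may be
      negative.\<close>
    define d where "d = h div 2 - 1"
    have d: "h = Suc (2 * Suc d)"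
      using False assms(1) unfolding d_def by (auto elim!: oddE)
    have "\<bar>b ! i\<bar> = b ! i" "\<bar>\<beta> ! i\<bar> = \<beta> ! i" if "i < Suc d" for i
      using pos[of i] pos'[of i] that by (auto simp: d)
    moreover have "\<bar>\<beta> ! Suc i\<bar> = \<beta> ! Suc i" if "i < d" for i
      using pos[of "Suc i"] that by (simp add: d)
    ultimately show ?thesis
      unfolding strip branches_def Let_def d by (auto simp: All_less_Suc)
  qed
qed


lemma weight_of_dominant:
  assumes "young_diagram \<nu>"
  shows "weight_of k \<nu> \<in> dominant_weights k"
proof -
  have mono: "row_len \<nu> j \<le> row_len \<nu> i" if "i \<le> j" for i j
  proof (rule ccontr)
    assume "\<not> row_len \<nu> j \<le> row_len \<nu> i"
    then have "(j, row_len \<nu> i) \<in> \<nu>"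
      using mem_iff_row_len[OF assms] by simp
    then have "(i, row_len \<nu> i) \<in> \<nu>"
      using young_diagramD[OF assms] that by blast
    then show False
      using mem_iff_row_len[OF assms] by simp
  qed
  have sorted: "sorted_wrt (\<ge>) (weight_of k' \<nu>)" for k'
    unfolding weight_of_def by (auto simp: sorted_wrt_iff_nth_less mono)
  show ?thesis
  proof (cases "k div 2 = 0")
    case True
    then show ?thesis
      by (simp add: dominant_weights_def weight_of_def)
  next
    case False
    then obtain m where m: "k div 2 = Suc m"
      by (meson not0_implies_Suc)
    then have "weight_of k \<nu> = map (\<lambda>i. int (row_len \<nu> i)) [0..<m] @ [int (row_len \<nu> m)]"
      by (simp add: weight_of_def)
    then show ?thesis
      using sorted[of k] mono by (auto simp: dominant_weights_def sorted_wrt_append m)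
  qed
qed

lemma sigma_dominant:
  assumes "\<beta> \<in> dominant_weights k" "even k" "k \<ge> 2"
  shows "sigma \<beta> \<in> dominant_weights k"
  using assms by (auto simp: dominant_weights_def sigma_def)

lemma length_sigma: "\<beta> \<noteq> [] \<Longrightarrow> length (sigma \<beta>) = length \<beta>"
  by (simp add: sigma_def)

lemma nth_sigma:
  "i < length \<beta> \<Longrightarrow> sigma \<beta> ! i = (if i = length \<beta> - 1 then - \<beta> ! i else \<beta> ! i)"
  by (cases "\<beta> = []") (auto simp: sigma_def nth_append nth_butlast last_conv_nth)

lemma diagram_of_sigma:
  assumes "\<beta> \<noteq> []"
  shows "diagram_of (sigma \<beta>) = diagram_of \<beta>"
  using assms by (auto simp: diagram_of_def length_sigma nth_sigma split: if_splits)

text \<open>The bound on the first column ensures that the \<open>k div 2\<close> coordinates cut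
  off no non-empty row.\<close>

lemma diagram_of_weight_of:
  assumes "young_diagram \<nu>" "2 * col_len \<nu> 0 \<le> k"
  shows "diagram_of (weight_of k \<nu>) = \<nu>"
proof (rule diagram_eqI)
  show "young_diagram (diagram_of (weight_of k \<nu>))"
    using young_diagram_of weight_of_dominant assms by blast
  show "row_len (diagram_of (weight_of k \<nu>)) i = row_len \<nu> i" for i
  proof (cases "i < k div 2")
    case False
    then have "col_len \<nu> 0 \<le> i"
      using assms(2) by linarith
    then show ?thesis
      using False col_len_0_le_iff[OF assms(1)] by (simp add: row_len_diagram_of weight_of_def)
  qed (simp add: row_len_diagram_of weight_of_def)
qed fact

text \<open>The alternatives that \<open>GTP\<close> allows at the top, considered at every
  height.\<close>

definition weights :: "nat \<Rightarrow> diagram \<Rightarrow> int list set" where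
  "weights k \<nu> = (if \<nu> \<noteq> dagger k \<nu> then {weight_of k (short_rep k \<nu>)}
     else {weight_of k \<nu>, sigma (weight_of k \<nu>)})"

text \<open>For the converse, \<open>\<beta>\<close> agrees with the weight of the short
  representative up to signs. A negative coordinate must be the last one at even height; being
  non-zero, it makes the first column reach half the height, so the diagram is self-dual and
  \<open>sigma\<close> is allowed.\<close>

lemma weights_iff:
  assumes "short_diagram k \<nu>" "k \<ge> 1"
  shows "\<beta> \<in> weights k \<nu> \<longleftrightarrow> \<beta> \<in> dominant_weights k \<and> diagram_of \<beta> = short_rep k \<nu>"
proof -
  let ?s = "short_rep k \<nu>"
  have y: "young_diagram ?s" and c: "2 * col_len ?s 0 \<le> k"
    using short_short_rep[OF assms(1)] col_len_short_rep[OF assms(1)]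
    unfolding short_diagram_def by auto
  have self_dual: "\<nu> = dagger k \<nu> \<longleftrightarrow> 2 * col_len ?s 0 = k"
    using self_dual_short_rep_iff[OF assms(1)] dagger_eq_iff[OF assms(1)] by simp
  have s_eq: "?s = \<nu>" if "\<nu> = dagger k \<nu>"
    using that by (simp add: short_rep_def)
  have w: "weight_of k ?s \<in> dominant_weights k" "diagram_of (weight_of k ?s) = ?s"
    using weight_of_dominant[OF y] diagram_of_weight_of[OF y c] by auto
  show ?thesis
  proof
    assume \<beta>: "\<beta> \<in> weights k \<nu>"
    show "\<beta> \<in> dominant_weights k \<and> diagram_of \<beta> = ?s"
    proof (cases "\<beta> = weight_of k ?s")
      case False
      then have "\<nu> = dagger k \<nu>" and \<beta>': "\<beta> = sigma (weight_of k ?s)"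
        using \<beta> s_eq by (auto simp: weights_def split: if_splits)
      \<comment> \<open>A self-dual shape has even height, here at least 2, so the weight is
        non-empty and \<open>last\<close> in \<open>sigma\<close> is an actual coordinate.\<close>
      then have "even k"
        using self_dual by (metis dvd_triv_left)
      then have "k \<ge> 2"
        using assms(2) by presburger
      then have "weight_of k ?s \<noteq> []"
        by (simp add: weight_of_def)
      then show ?thesis
        using sigma_dominant[OF w(1) \<open>even k\<close> \<open>k \<ge> 2\<close>] diagram_of_sigma w(2) \<beta>' by simp
    qed (use w in simp)
  next
    assume *: "\<beta> \<in> dominant_weights k \<and> diagram_of \<beta> = ?s"
    have len: "length \<beta> = k div 2"
      using * by (simp add: dominant_weights_def)
    have row: "row_len ?s i = nat \<bar>\<beta> ! i\<bar>" if "i < k div 2" for i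
      using * row_len_diagram_of[of \<beta> i] that len by simp
    have abs: "weight_of k ?s = map abs \<beta>"
      by (rule nth_equalityI) (auto simp: weight_of_def len row)
    show "\<beta> \<in> weights k \<nu>"
    proof (cases "\<forall>i < k div 2. 0 \<le> \<beta> ! i")
      case True
      then have "\<beta> = weight_of k ?s"
        unfolding abs by (intro nth_equalityI) (auto simp: len)
      then show ?thesis
        using s_eq by (auto simp: weights_def)
    next
      case False
      then obtain i where i: "i < k div 2" "\<beta> ! i < 0"
        by (auto simp: not_le)
      then have "\<not> i < (k - 1) div 2"
        using dominant_weights_nonneg[of \<beta> k i] * by auto
      then have ik: "i = k div 2 - 1" "even k"
        using i(1) by presburger+
      have "row_len ?s i \<noteq> 0"
        using row[OF i(1)] i(2) by simp
      then have "\<not> col_len ?s 0 \<le> i"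
        using col_len_0_le_iff[OF y] by simp
      then have "\<nu> = dagger k \<nu>"
        using c ik i(1) self_dual by (auto elim!: evenE)
      moreover have "\<beta> = sigma (weight_of k ?s)"
      proof (rule nth_equalityI)
        have ne: "map abs \<beta> \<noteq> []"
          using i len by auto
        then show "length \<beta> = length (sigma (weight_of k ?s))"
          by (simp add: abs length_sigma)
        fix j assume j: "j < length \<beta>"
        show "\<beta> ! j = sigma (weight_of k ?s) ! j"
        proof (cases "j = i")
          case True
          then show ?thesis
            using i(2) ik(1) j by (simp add: abs nth_sigma len)
        next
          case False
          then have "j < (k - 1) div 2"
            using j ik by (auto simp: len elim!: evenE)
          then have "0 \<le> \<beta> ! j"
            using dominant_weights_nonneg * by blast
          then show ?thesis
            using False ik(1) j by (simp add: abs nth_sigma len)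
        qed
      qed
      ultimately show ?thesis
        using s_eq by (auto simp: weights_def)
    qed
  qed
qed

section \<open>Signs of weights and parities of the diagrams below\<close>

text \<open>The entry of \<open>J_map\<close> at height \<open>k\<close> in terms of two
  neighbouring diagrams, with the power of \<open>-1\<close> turned into a parity. It is used at all
  heights from 1 on, so that \<open>z\<close> becomes the entry at height 2.\<close>

definition pattern_weight :: "nat \<Rightarrow> diagram \<Rightarrow> diagram \<Rightarrow> int list" where
  "pattern_weight k \<kappa> \<mu> = (if \<kappa> \<noteq> dagger k \<kappa> then weight_of k (short_rep k \<kappa>)
     else if even (card \<mu>) then weight_of k \<kappa> else sigma (weight_of k \<kappa>))"

lemma pattern_weight_in_weights: "pattern_weight k \<kappa> \<mu> \<in> weights k \<kappa>"
  by (simp add: pattern_weight_def weights_def)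

text \<open>For a self-dual shape the two admissible weights are distinct, so the weight records the
  parity faithfully.\<close>

lemma pattern_weight_eq_iff:
  assumes "short_diagram k \<kappa>" "k \<ge> 1" "\<beta> \<in> weights k \<kappa>"
  shows "pattern_weight k \<kappa> \<mu> = \<beta> \<longleftrightarrow>
    (2 * col_len \<kappa> 0 = k \<longrightarrow> (even (card \<mu>) \<longleftrightarrow> \<beta> = weight_of k \<kappa>))"
proof (cases "2 * col_len \<kappa> 0 = k")
  case True
  have y: "young_diagram \<kappa>"
    using assms(1) by (simp add: short_diagram_def)
  \<comment> \<open>The index of the last coordinate; a first column of \<open>k div 2\<close> boxes
    makes row \<open>i\<close> non-empty, so \<open>sigma\<close> changes this coordinate.\<close>
  define i where "i = k div 2 - 1"
  have i: "i < k div 2" "i < col_len \<kappa> 0"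
    using True assms(2) by (auto simp: i_def)
  then have "row_len \<kappa> i > 0"
    using col_len_0_le_iff[OF y, of i] by linarith
  then have "sigma (weight_of k \<kappa>) ! i \<noteq> weight_of k \<kappa> ! i"
    using i(1) by (simp add: nth_sigma weight_of_def i_def)
  then have "sigma (weight_of k \<kappa>) \<noteq> weight_of k \<kappa>"
    by metis
  then show ?thesis
    using True assms(3) dagger_eq_iff[OF assms(1)]
    by (auto simp: pattern_weight_def weights_def split: if_splits)
next
  case False
  then show ?thesis
    using assms(3) dagger_eq_iff[OF assms(1)] by (simp add: pattern_weight_def weights_def)
qed

text \<open>This is \<open>ex1_strip_step\<close> with \<open>e\<close> taken to be
  \<open>\<beta> = weight_of (Suc h) \<kappa>\<close>; the width bound passes from
  \<open>\<kappa>\<close> to \<open>\<mu>\<close> by inclusion.\<close>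

lemma ex1_pattern_step:
  assumes "h \<ge> 1" "\<kappa> \<in> SYD (Suc h) n" "\<beta> \<in> weights (Suc h) \<kappa>"
    and "young_diagram \<mu>\<^sub>0" "2 * col_len \<mu>\<^sub>0 0 \<le> h" "strip_step (short_rep (Suc h) \<kappa>) \<mu>\<^sub>0"
  shows "\<exists>!\<mu>. \<mu> \<in> SYD h n \<and> strip_step \<kappa> \<mu> \<and> short_rep h \<mu> = \<mu>\<^sub>0 \<and> pattern_weight (Suc h) \<kappa> \<mu> = \<beta>"
proof -
  have \<kappa>: "short_diagram (Suc h) \<kappa>" "row_len \<kappa> 0 \<le> n"
    using assms(2) by (auto simp: SYD_iff)
  have "\<mu> \<in> SYD h n \<longleftrightarrow> short_diagram h \<mu>" if "strip_step \<kappa> \<mu>" for \<mu>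
    using that row_len_mono[of \<mu> \<kappa> 0] \<kappa> by (auto simp: SYD_iff strip_step_def short_diagram_def)
  then have "(\<mu> \<in> SYD h n \<and> strip_step \<kappa> \<mu> \<and> short_rep h \<mu> = \<mu>\<^sub>0 \<and> pattern_weight (Suc h) \<kappa> \<mu> = \<beta>) \<longleftrightarrow>
    (short_diagram h \<mu> \<and> strip_step \<kappa> \<mu> \<and> short_rep h \<mu> = \<mu>\<^sub>0 \<and>
      (2 * col_len \<kappa> 0 = Suc h \<longrightarrow> (even (card \<mu>) \<longleftrightarrow> \<beta> = weight_of (Suc h) \<kappa>)))" for \<mu>
    using pattern_weight_eq_iff[OF \<kappa>(1) _ assms(3)] by auto
  then show ?thesis
    using ex1_strip_step[OF \<kappa>(1) assms(4-6)] by presburger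
qed

section \<open>Rebuilding a tableau from its top\<close>

lemma SSSYT_iff:
  "T \<in> SSSYT N n \<nu> \<longleftrightarrow> T \<in> (\<Pi>\<^sub>E i\<in>{1..N}. SYD i n) \<and> T N = \<nu> \<and>
    (\<forall>i. 1 \<le> i \<and> i < N \<longrightarrow> strip_step (T (Suc i)) (T i))"
  by (auto simp: SSSYT_def strip_step_def)

text \<open>Cutting off the top diagram resets its index to \<open>undefined\<close>, because
  tableaux are extensional functions.\<close>

lemma SSSYT_Suc_iff:
  assumes "h \<ge> 1"
  shows "T \<in> SSSYT (Suc h) n \<kappa> \<longleftrightarrow> \<kappa> \<in> SYD (Suc h) n \<and> T (Suc h) = \<kappa> \<and> strip_step \<kappa> (T h) \<and>
    T(Suc h := undefined) \<in> SSSYT h n (T h)"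
proof -
  have "T \<in> (\<Pi>\<^sub>E i\<in>{1..Suc h}. SYD i n) \<longleftrightarrow>
    T (Suc h) \<in> SYD (Suc h) n \<and> T(Suc h := undefined) \<in> (\<Pi>\<^sub>E i\<in>{1..h}. SYD i n)"
    using assms by (auto simp: PiE_iff extensional_def atLeastAtMostSuc_conv)
  moreover have "(\<forall>i. 1 \<le> i \<and> i < Suc h \<longrightarrow> strip_step (T (Suc i)) (T i)) \<longleftrightarrow>
    strip_step (T (Suc h)) (T h) \<and> (\<forall>i. 1 \<le> i \<and> i < h \<longrightarrow> strip_step (T (Suc i)) (T i))"
    using assms by (auto simp: less_Suc_eq)
  ultimately show ?thesis
    by (auto simp: SSSYT_iff)
qed

text \<open>The tableau is determined downwards: \<open>ex1_pattern_step\<close> yields the diagram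
  at height \<open>h\<close>, which becomes the prescribed top of the shorter tableau. Hence
  \<open>\<kappa>\<close> is arbitrary in the induction.\<close>

lemma ex1_SSSYT:
  assumes "N \<ge> 1" "\<kappa> \<in> SYD N n" "diagram_of (\<beta> N) = short_rep N \<kappa>"
    and "\<And>k. 1 \<le> k \<Longrightarrow> k \<le> N \<Longrightarrow> \<beta> k \<in> dominant_weights k"
    and "\<And>h. 1 \<le> h \<Longrightarrow> h < N \<Longrightarrow> strip_step (diagram_of (\<beta> (Suc h))) (diagram_of (\<beta> h))"
  shows "\<exists>!T. T \<in> SSSYT N n \<kappa> \<and> (\<forall>k\<in>{1..N}. pattern_weight k (T k) (T (k - 1)) = \<beta> k)"
  using assms
proof (induction N arbitrary: \<kappa> rule: dec_induct)
  case base
  have "short_diagram 1 \<kappa>"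
    using base by (simp add: SYD_iff)
  \<comment> \<open>Height 1 is odd, so no diagram is self-dual and the value is \<open>[]\<close>
    for any \<open>\<mu>\<close>. This covers \<open>T 0\<close>, which lies outside the index
    set.\<close>
  then have "\<kappa> \<noteq> dagger 1 \<kappa>"
    using dagger_eq_iff by (metis dvd_triv_left odd_one)
  moreover have "\<beta> 1 = []"
    using base(3)[of 1] by (simp add: dominant_weights_def)
  ultimately have "pattern_weight 1 \<kappa> \<mu> = \<beta> 1" for \<mu>
    by (simp add: pattern_weight_def weight_of_def)
  moreover have "T \<in> SSSYT 1 n \<kappa> \<longleftrightarrow> T = (\<lambda>i\<in>{1}. \<kappa>)" for T
    using base(1) by (auto simp: SSSYT_iff PiE_iff extensional_def fun_eq_iff)
  ultimately show ?case
    by (intro ex1I[of _ "\<lambda>i\<in>{1}. \<kappa>"]) auto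
next
  case (step h)
  let ?P = "\<lambda>h \<kappa> T. T \<in> SSSYT h n \<kappa> \<and> (\<forall>k\<in>{1..h}. pattern_weight k (T k) (T (k - 1)) = \<beta> k)"
  have h: "h \<ge> 1"
    by fact
  have "short_diagram (Suc h) \<kappa>"
    using step.prems(1) by (simp add: SYD_iff)
  then have w: "\<beta> (Suc h) \<in> weights (Suc h) \<kappa>"
    using weights_iff step.prems(2) step.prems(3)[of "Suc h"] by simp
  have dom: "\<beta> h \<in> dominant_weights h"
    using step.prems(3)[of h] h by simp
  have "strip_step (short_rep (Suc h) \<kappa>) (diagram_of (\<beta> h))"
    using step.prems(2) step.prems(4)[of h] h by simp
  from ex1_pattern_step[OF h step.prems(1) w young_diagram_of[OF dom] col_len_diagram_of[OF dom] this]
  obtain \<mu> where \<mu>: "\<mu> \<in> SYD h n \<and> strip_step \<kappa> \<mu> \<and> short_rep h \<mu> = diagram_of (\<beta> h) \<and>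
      pattern_weight (Suc h) \<kappa> \<mu> = \<beta> (Suc h)"
    and \<mu>_unique: "\<forall>\<mu>'. \<mu>' \<in> SYD h n \<and> strip_step \<kappa> \<mu>' \<and> short_rep h \<mu>' = diagram_of (\<beta> h) \<and>
      pattern_weight (Suc h) \<kappa> \<mu>' = \<beta> (Suc h) \<longrightarrow> \<mu>' = \<mu>"
    by (rule ex1E)
  have "\<exists>!T. ?P h \<mu> T"
    using step.prems(3,4) \<mu> by (intro step.IH) auto
  then obtain T where T: "?P h \<mu> T" and T_unique: "\<forall>T'. ?P h \<mu> T' \<longrightarrow> T' = T"
    by (rule ex1E)
  have Th: "T h = \<mu>" "T (Suc h) = undefined"
    using T by (auto simp: SSSYT_iff PiE_iff extensional_def)
  show ?case
  proof (rule ex1I)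
    let ?T = "T(Suc h := \<kappa>)"
    have "?T(Suc h := undefined) = T"
      using Th(2) by (simp add: fun_eq_iff)
    then have "?T \<in> SSSYT (Suc h) n \<kappa>"
      using T \<mu> Th step.prems(1) h by (simp add: SSSYT_Suc_iff)
    moreover have "pattern_weight k (?T k) (?T (k - 1)) = \<beta> k" if "k \<in> {1..Suc h}" for k
      using that T \<mu> Th by (cases "k = Suc h") auto
    ultimately show "?P (Suc h) \<kappa> ?T"
      by blast
    fix S assume S: "?P (Suc h) \<kappa> S"
    then have Sh: "S (Suc h) = \<kappa>" "strip_step \<kappa> (S h)" "S(Suc h := undefined) \<in> SSSYT h n (S h)"
      using SSSYT_Suc_iff[OF h] by auto
    then have SYD: "S h \<in> SYD h n"
      using h by (auto simp: SSSYT_iff PiE_iff)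
    \<comment> \<open>To identify \<open>S h\<close> with \<open>\<mu>\<close> its short
      representative must be known; it is read off the prescribed weight at height
      \<open>h\<close>.\<close>
    have "pattern_weight h (S h) (S (h - 1)) = \<beta> h"
      using S h by auto
    then have "diagram_of (\<beta> h) = short_rep h (S h)"
      using pattern_weight_in_weights[of h "S h" "S (h - 1)"] weights_iff SYD h SYD_iff by metis
    moreover have "pattern_weight (Suc h) \<kappa> (S h) = \<beta> (Suc h)"
      using bspec[OF conjunct2[OF S], of "Suc h"] Sh(1) by simp
    ultimately have "S h = \<mu>"
      using \<mu>_unique SYD Sh(2) by simp
    then have "?P h \<mu> (S(Suc h := undefined))"
      using S Sh by auto
    then have "S(Suc h := undefined) = T"
      using T_unique by blast
    then show "S = ?T"
      using Sh(1) by auto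
  qed
qed

section \<open>Patterns extended down to height 1\<close>

definition extend_pattern :: "(nat \<Rightarrow> int list) \<times> int \<Rightarrow> nat \<Rightarrow> int list" where
  "extend_pattern p = (fst p)(2 := [snd p], 1 := [])"

text \<open>The alternative at the top becomes a condition on diagrams by
  \<open>weights_iff\<close>, and branching becomes strip steps. Of the two steps added at the
  bottom, the one from height 3 to 2 is the bound on \<open>z\<close>, and the one from 2 to 1
  always holds.\<close>

lemma GTP_iff:
  assumes "N \<ge> 3" "\<nu> \<in> SYD N n"
  shows "p \<in> GTP N \<nu> \<longleftrightarrow> fst p \<in> extensional {3..N} \<and>
    (\<forall>k. 1 \<le> k \<and> k \<le> N \<longrightarrow> extend_pattern p k \<in> dominant_weights k) \<and>
    diagram_of (extend_pattern p N) = short_rep N \<nu> \<and>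
    (\<forall>h. 1 \<le> h \<and> h < N \<longrightarrow>
      strip_step (diagram_of (extend_pattern p (Suc h))) (diagram_of (extend_pattern p h)))"
    (is "?L \<longleftrightarrow> ?E \<and> ?D \<and> ?T \<and> ?S")
proof -
  obtain \<beta> z where p: "p = (\<beta>, z)"
    by fastforce
  let ?e = "extend_pattern p"
  have e: "?e 1 = []" "?e 2 = [z]" "\<And>k. k \<ge> 3 \<Longrightarrow> ?e k = \<beta> k"
    by (auto simp: extend_pattern_def p)
  have dom12: "[] \<in> dominant_weights 1" "[z] \<in> dominant_weights 2"
    by (auto simp: dominant_weights_def)
  have cases: "k = 1 \<or> k = 2 \<or> k \<ge> 3" if "1 \<le> k" for k :: nat
    using that by linarith
  have D: "?D \<longleftrightarrow> (\<forall>k. 3 \<le> k \<and> k \<le> N \<longrightarrow> \<beta> k \<in> dominant_weights k)"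
    using cases e dom12 by (metis le_trans one_le_numeral)
  \<comment> \<open>The diagram of \<open>[z]\<close> has at most one row, so all of it is a
    horizontal strip.\<close>
  have step1: "strip_step (diagram_of [z]) (diagram_of [])"
    using strip_step_iff_row_len[OF young_diagram_of[OF dom12(2)] young_diagram_of[OF dom12(1)]]
    by (simp add: row_len_diagram_of)
  have step2: "strip_step (diagram_of (\<beta> 3)) (diagram_of [z]) \<longleftrightarrow> \<beta> 3 ! 0 \<ge> \<bar>z\<bar>"
    if "\<beta> 3 \<in> dominant_weights 3"
    using branches_iff_strip_step[of 2 "\<beta> 3" "[z]"] that dom12
    by (simp add: branches_def Let_def numeral_3_eq_3[symmetric])
  have S: "?S \<longleftrightarrow> \<beta> 3 ! 0 \<ge> \<bar>z\<bar> \<and> (\<forall>k. 4 \<le> k \<and> k \<le> N \<longrightarrow> branches k (\<beta> k) (\<beta> (k - 1)))" if ?D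
  proof -
    have range: "1 \<le> h \<and> h < N \<longleftrightarrow> h = 1 \<or> h = 2 \<or> 3 \<le> h \<and> h < N" for h
      using assms(1) by linarith
    have "Suc 1 = 2" "Suc 2 = 3"
      by simp_all
    then have "?S \<longleftrightarrow> strip_step (diagram_of (?e 3)) (diagram_of (?e 2)) \<and>
      (\<forall>h. 3 \<le> h \<and> h < N \<longrightarrow> strip_step (diagram_of (?e (Suc h))) (diagram_of (?e h)))"
      unfolding range using e(1,2) step1 by metis
    also have "strip_step (diagram_of (?e 3)) (diagram_of (?e 2)) \<longleftrightarrow> \<beta> 3 ! 0 \<ge> \<bar>z\<bar>"
      using step2 e that D assms(1) by simp
    also have "(\<forall>h. 3 \<le> h \<and> h < N \<longrightarrow> strip_step (diagram_of (?e (Suc h))) (diagram_of (?e h))) \<longleftrightarrow>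
      (\<forall>h. 3 \<le> h \<and> h < N \<longrightarrow> branches (Suc h) (\<beta> (Suc h)) (\<beta> h))"
      using that D e(3) branches_iff_strip_step by simp
    also have "\<dots> \<longleftrightarrow> (\<forall>k. 4 \<le> k \<and> k \<le> N \<longrightarrow> branches k (\<beta> k) (\<beta> (k - 1)))"
    proof (intro iffI allI impI)
      fix k assume *: "\<forall>h. 3 \<le> h \<and> h < N \<longrightarrow> branches (Suc h) (\<beta> (Suc h)) (\<beta> h)" "4 \<le> k \<and> k \<le> N"
      then show "branches k (\<beta> k) (\<beta> (k - 1))"
        using *(1)[rule_format, of "k - 1"] by fastforce
    next
      fix h assume *: "\<forall>k. 4 \<le> k \<and> k \<le> N \<longrightarrow> branches k (\<beta> k) (\<beta> (k - 1))" "3 \<le> h \<and> h < N"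
      then show "branches (Suc h) (\<beta> (Suc h)) (\<beta> h)"
        using *(1)[rule_format, of "Suc h"] by simp
    qed
    finally show ?thesis .
  qed
  have "short_diagram N \<nu>"
    using assms(2) by (simp add: SYD_iff)
  then have T: "?T \<longleftrightarrow> \<beta> N \<in> weights N \<nu>" if ?D
    using weights_iff[of N \<nu> "\<beta> N"] that assms(1) e(3) D by simp
  have "?L \<longleftrightarrow> ?E \<and> ?D \<and> \<beta> N \<in> weights N \<nu> \<and> \<beta> 3 ! 0 \<ge> \<bar>z\<bar> \<and>
      (\<forall>k. 4 \<le> k \<and> k \<le> N \<longrightarrow> branches k (\<beta> k) (\<beta> (k - 1)))"
    unfolding D by (auto simp: GTP_def weights_def p PiE_iff)
  then show ?thesis
    using S T by blast
qed

lemma diagram_height_1_cases: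
  assumes "\<mu> \<in> SYD 1 n"
  shows "\<mu> = {} \<or> \<mu> = {(0, 0)}"
proof -
  have y: "young_diagram \<mu>" and c: "col_len \<mu> 0 + col_len \<mu> 1 \<le> 1"
    using assms by (auto simp: SYD_def)
  have "col_len \<mu> (Suc j) = 0" for j
    using c col_len_antimono[OF y, of 1 "Suc j"] col_len_antimono[OF y, of 0 1] by simp
  then have mem: "(i, j) \<in> \<mu> \<longleftrightarrow> j = 0 \<and> i < col_len \<mu> 0" for i j
    using mem_iff_col_len[OF y] by (cases j) auto
  show ?thesis
    using c by (cases "col_len \<mu> 0") (auto simp: mem)
qed

text \<open>At height 2 the short representative has at most one row, whose length is its size. The
  row is non-empty exactly in the self-dual case, where the parity of \<open>\<mu>\<close> gives the
  sign; otherwise both signs give 0.\<close>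

lemma pattern_weight_2:
  assumes "\<kappa> \<in> SYD 2 n" "\<mu> \<in> SYD 1 n"
  shows "pattern_weight 2 \<kappa> \<mu> =
    [if \<mu> = {} then int (card (short_rep 2 \<kappa>)) else - int (card (short_rep 2 \<kappa>))]"
proof -
  let ?s = "short_rep 2 \<kappa>"
  have \<kappa>: "short_diagram 2 \<kappa>"
    using assms(1) by (simp add: SYD_iff)
  have y: "young_diagram ?s" and c: "2 * col_len ?s 0 \<le> 2"
    using short_short_rep[OF \<kappa>] col_len_short_rep[OF \<kappa>] unfolding short_diagram_def by auto
  have "row_len ?s i = 0" if "i > 0" for i
    using that c col_len_0_le_iff[OF y, of i] by linarith
  then have "?s = {0} \<times> {..<row_len ?s 0}"
    using mem_iff_row_len[OF y] by (auto, (metis gr0I less_nat_zero_code)+)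
  then have card: "card ?s = row_len ?s 0"
    by (metis card_cartesian_product_singleton card_lessThan)
  have even: "even (card \<mu>) \<longleftrightarrow> \<mu> = {}"
    using diagram_height_1_cases[OF assms(2)] by auto
  show ?thesis
  proof (cases "\<kappa> = dagger 2 \<kappa>")
    case True
    then have "?s = \<kappa>"
      by (simp add: short_rep_def)
    then show ?thesis
      using True even card by (simp add: pattern_weight_def weight_of_def sigma_def)
  next
    case False
    then have "col_len ?s 0 = 0"
      using c dagger_eq_iff[OF \<kappa>] self_dual_short_rep_iff[OF \<kappa>] by simp
    then have "row_len ?s 0 = 0"
      using col_len_0_le_iff[OF y] by simp
    then show ?thesis
      using False card by (simp add: pattern_weight_def weight_of_def)
  qed
qed

lemma extend_pattern_J_map:
  assumes "N \<ge> 3" "T \<in> SSSYT N n \<nu>" "1 \<le> k" "k \<le> N"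
  shows "extend_pattern (J_map N T) k = pattern_weight k (T k) (T (k - 1))"
proof -
  have SYD: "T i \<in> SYD i n" if "1 \<le> i" "i \<le> N" for i
    using assms(2) that by (auto simp: SSSYT_iff PiE_iff)
  consider "k = 1" | "k = 2" | "k \<ge> 3"
    using assms(3) by linarith
  then show ?thesis
  proof cases
    case 1
    have "short_diagram 1 (T 1)"
      using SYD[of 1] assms(1) by (simp add: SYD_iff)
    then have "T 1 \<noteq> dagger 1 (T 1)"
      using dagger_eq_iff by (metis dvd_triv_left odd_one)
    then show ?thesis
      by (simp add: 1 extend_pattern_def pattern_weight_def weight_of_def)
  next
    case 2
    then show ?thesis
      using pattern_weight_2[OF SYD[of 2] SYD[of 1]] assms(1) by (simp add: extend_pattern_def J_map_def)
  next
    case 3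
    then show ?thesis
      using assms(4) by (auto simp: extend_pattern_def J_map_def pattern_weight_def minus_one_power_iff)
  qed
qed

lemma extend_pattern_inject:
  assumes "N \<ge> 3" "fst p \<in> extensional {3..N}" "fst q \<in> extensional {3..N}"
    and "\<And>k. 1 \<le> k \<Longrightarrow> k \<le> N \<Longrightarrow> extend_pattern p k = extend_pattern q k"
  shows "p = q"
proof (rule prod_eqI)
  show "fst p = fst q"
  proof (rule extensionalityI[OF assms(2,3)])
    fix k assume "k \<in> {3..N}"
    then show "fst p k = fst q k"
      using assms(4)[of k] by (simp add: extend_pattern_def)
  qed
  show "snd p = snd q"
    using assms(1) assms(4)[of 2] by (simp add: extend_pattern_def)
qed

section \<open>Bijectivity\<close>

theorem corollary7p17:
  fixes N n :: nat and \<nu> :: diagram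
  assumes "n \<ge> 2" and "N \<ge> 3" and "\<nu> \<in> SYD N n"
  shows "bij_betw (J_map N) (SSSYT N n \<nu>) (GTP N \<nu>)"
proof -
  have ext: "fst (J_map N T) \<in> extensional {3..N}" for T
    by (simp add: J_map_def)
  have into: "J_map N T \<in> GTP N \<nu>" if T: "T \<in> SSSYT N n \<nu>" for T
  proof -
    have short: "short_diagram k (T k)" if "1 \<le> k" "k \<le> N" for k
      using T that by (auto simp: SSSYT_iff PiE_iff SYD_iff)
    have "extend_pattern (J_map N T) k \<in> dominant_weights k \<and>
        diagram_of (extend_pattern (J_map N T) k) = short_rep k (T k)" if "1 \<le> k" "k \<le> N" for k
      using extend_pattern_J_map[OF assms(2) T that] weights_iff[OF short[OF that] that(1)]
        pattern_weight_in_weights by metis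
    moreover have "strip_step (short_rep (Suc h) (T (Suc h))) (short_rep h (T h))"
      if "1 \<le> h" "h < N" for h
      using strip_step_short_rep short[of "Suc h"] short[of h] T that by (simp add: SSSYT_iff)
    moreover have "T N = \<nu>"
      using T by (simp add: SSSYT_iff)
    ultimately show ?thesis
      using GTP_iff[OF assms(2,3)] ext assms(2) by auto
  qed
  \<comment> \<open>A unique preimage for every pattern gives injectivity and surjectivity together,
    since \<open>into\<close> places all images among the patterns.\<close>
  have "\<exists>!T. T \<in> SSSYT N n \<nu> \<and> J_map N T = p" if p: "p \<in> GTP N \<nu>" for p
  proof -
    note G = p[unfolded GTP_iff[OF assms(2,3)]]
    \<comment> \<open>Both first components are extensional, so equality can be tested height by
      height on the extended patterns.\<close>
    have "J_map N T = p \<longleftrightarrow> (\<forall>k\<in>{1..N}. pattern_weight k (T k) (T (k - 1)) = extend_pattern p k)"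
      if T: "T \<in> SSSYT N n \<nu>" for T
      using extend_pattern_J_map[OF assms(2) T] extend_pattern_inject[OF assms(2) ext, of p T] G
      by (metis atLeastAtMost_iff)
    moreover have "\<exists>!T. T \<in> SSSYT N n \<nu> \<and>
        (\<forall>k\<in>{1..N}. pattern_weight k (T k) (T (k - 1)) = extend_pattern p k)"
      using G assms by (intro ex1_SSSYT) auto
    ultimately show ?thesis
      by blast
  qed
  then show ?thesis
    using into unfolding bij_betw_def inj_on_def image_def by blast
qed

end
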